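(* Fix $\gamma \in (0,1]$, and let $f \colon [0,1] \to [0,1]$, $$ f(x) = \begin{cases} x\Bigl(1 + \dfrac{c}{|\log x|^\beta}\Bigr), & x \leq 1/2, \\ 2 x - 1, & x > 1/2, \end{cases} $$ with $\beta = \gamma^{-1} - 1$ and $c=(\log 2)^\beta$ (so that $f(1/2) = 1$; $f(0)=0$). Let $Y = (1/2,1]$, let $\tau(x) = \inf \{k \geq 1 : f^k(x) \in Y\}$ for $x \in Y$ be the first return time, let $F \colon Y \to Y$, $F(x) = f^{\tau(x)}(x)$, be the induced map, let $\alpha$ be the partition of $Y$ into the intervals where $\tau$ is constant, and let $m$ be Lebesgue measure. Then $f$ is a nonuniformly expanding map with base $Y$, return time $\tau$ and reference measure $m$. That is, there exists $C > 0$ such that for every $a \in \alpha$ and all $x,y \in a$: (a) $F \colon a \to Y$ is a nonsingular bijection; (b) $F$ is expanding: $|F(y) - F(x)| \geq 2 |y-x|$; (c) $F$ has bounded distortion: $|\log F'(y) - \log F'(x)| \leq C |F(y) - F(x)|$. Further, there exist $\eta_1, \eta_2 > 0$ such that for all $n \geq 1$: (d) $\mathrm{e}^{-\eta_2 n^\gamma} \leq m(\tau \geq n) \leq \mathrm{e}^{-\eta_1 n^\gamma}$.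
   Context: Here $m(\tau \ge n) = m(\{x \in Y : \tau(x) \ge n\})$, with $m$ the (unnormalized) Lebesgue measure on $Y=(1/2,1]$. For $x \in a \in \alpha$, $F'(x)$ denotes the derivative of the restriction $F|_a$ (one-sided at an endpoint of $a$). "Nonsingular" means that images and preimages under $F|_a$ of Lebesgue-null sets are Lebesgue-null. For this theorem "nonuniformly expanding" is meant in the sense spelled out by items (a)–(c) of the claim. *)

theory Defs
  imports "HOL-Analysis.Analysis"
begin

text \<open>
  The map is only of interest on \<open>[0,1]\<close>, which it preserves (see \<open>imap_unit_interval\<close>);
  the junk value \<open>ln 0 = 0\<close> is harmless because of the factor \<open>x\<close>, which gives
  \<open>imap \<gamma> 0 = 0\<close>.
\<close>

definition imap :: "real \<Rightarrow> real \<Rightarrow> real" where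
  "imap \<gamma> x =
     (let \<beta> = 1 / \<gamma> - 1; c = ln 2 powr \<beta>
      in if x \<le> 1/2 then x * (1 + c / \<bar>ln x\<bar> powr \<beta>) else 2 * x - 1)"

definition base :: "real set" where
  "base = {1/2<..1}"

text \<open>
  On \<open>nat\<close> the infimum of the empty set is \<open>0\<close>; by \<open>imap_returns\<close> below this case does not
  occur for points of the base.
\<close>

definition return_time :: "('a \<Rightarrow> 'a) \<Rightarrow> 'a set \<Rightarrow> 'a \<Rightarrow> nat" where
  "return_time f Y x = Inf {k. k \<ge> 1 \<and> (f ^^ k) x \<in> Y}"

definition induced_map :: "('a \<Rightarrow> 'a) \<Rightarrow> 'a set \<Rightarrow> 'a \<Rightarrow> 'a" where
  "induced_map f Y x = (f ^^ return_time f Y x) x"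

text \<open>
  The connected components of a subset of the line are its maximal subintervals, so this is the
  partition of \<open>Y\<close> into the maximal intervals on which the return time is constant.
\<close>

definition return_partition :: "(real \<Rightarrow> real) \<Rightarrow> real set \<Rightarrow> real set set" where
  "return_partition f Y = (\<Union>n. components {x \<in> Y. return_time f Y x = n})"

definition nonsingular_on :: "(real \<Rightarrow> real) \<Rightarrow> real set \<Rightarrow> bool" where
  "nonsingular_on F a \<longleftrightarrow>
     (\<forall>N \<in> null_sets lebesgue.
        F ` (a \<inter> N) \<in> null_sets lebesgue \<and> a \<inter> F -` N \<in> null_sets lebesgue)"

lemma imap_half: "imap \<gamma> (1/2) = 1"
  by (simp add: imap_def Let_def ln_div)

lemma imap_left:
  assumes "0 < x" "x \<le> 1/2" "0 < \<gamma>" "\<gamma> \<le> 1"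
  shows "x < imap \<gamma> x" "imap \<gamma> x \<le> 1"
proof -
  define \<beta> where "\<beta> = 1 / \<gamma> - 1"
  have \<beta>: "\<beta> \<ge> 0" using assms by (simp add: \<beta>_def)
  have "ln x \<le> ln (1/2)" using assms by (subst ln_le_cancel_iff) auto
  then have l: "ln 2 \<le> \<bar>ln x\<bar>" "\<bar>ln x\<bar> > 0"
    using ln_gt_zero[of "2::real"] by (auto simp: ln_div)
  have q: "0 < ln 2 powr \<beta> / \<bar>ln x\<bar> powr \<beta>" using l by simp
  have "ln 2 powr \<beta> \<le> \<bar>ln x\<bar> powr \<beta>" using l \<beta> by (intro powr_mono2) auto
  then have q1: "ln 2 powr \<beta> / \<bar>ln x\<bar> powr \<beta> \<le> 1" using l by (simp add: divide_le_eq)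
  have e: "imap \<gamma> x = x * (1 + ln 2 powr \<beta> / \<bar>ln x\<bar> powr \<beta>)"
    using assms by (simp add: imap_def Let_def \<beta>_def)
  have "x * 1 < x * (1 + ln 2 powr \<beta> / \<bar>ln x\<bar> powr \<beta>)"
    using q assms(1) by (intro mult_strict_left_mono) auto
  then show "x < imap \<gamma> x" unfolding e by simp
  have "x * (1 + ln 2 powr \<beta> / \<bar>ln x\<bar> powr \<beta>) \<le> x * 2"
    using q1 assms(1) by (intro mult_left_mono) auto
  then show "imap \<gamma> x \<le> 1" unfolding e using assms(2) by linarith
qed

lemma imap_unit_interval:
  assumes "0 < \<gamma>" "\<gamma> \<le> 1" "x \<in> {0..1}"
  shows "imap \<gamma> x \<in> {0..1}"
proof (cases "0 < x \<and> x \<le> 1/2")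
  case True
  then show ?thesis using imap_left[of x \<gamma>] assms by auto
next
  case False
  then show ?thesis using assms by (auto simp: imap_def Let_def)
qed

lemma imap_returns:
  assumes "0 < \<gamma>" "\<gamma> \<le> 1" "x \<in> base"
  shows "\<exists>k\<ge>1. (imap \<gamma> ^^ k) x \<in> base"
proof (rule ccontr)
  assume no: "\<not> ?thesis"
  define \<beta> where "\<beta> = 1 / \<gamma> - 1"
  define y where "y = imap \<gamma> x"
  define d where "d = ln 2 powr \<beta> / \<bar>ln y\<bar> powr \<beta>"
  have \<beta>: "\<beta> \<ge> 0" using assms by (simp add: \<beta>_def)
  have y: "0 < y" "y \<le> 1"
    using assms(3) by (auto simp: y_def imap_def base_def Let_def)
  have step: "(imap \<gamma> ^^ Suc k) x \<le> 1/2" if "(imap \<gamma> ^^ Suc k) x \<le> 1" for k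
    using no that by (force simp: base_def simp del: funpow.simps)
  have y2: "y \<le> 1/2" using step[of 0] y by (simp add: y_def)
  have d: "d > 0" using y y2 by (simp add: d_def)
  have grow: "y * (1 + d) ^ k \<le> (imap \<gamma> ^^ Suc k) x \<and> (imap \<gamma> ^^ Suc k) x \<le> 1/2" for k
  proof (induction k)
    case 0
    then show ?case using y2 by (simp add: y_def)
  next
    case (Suc k)
    define z where "z = (imap \<gamma> ^^ Suc k) x"
    have z: "y * (1 + d) ^ k \<le> z" "z \<le> 1/2" using Suc by (auto simp: z_def)
    have "1 \<le> (1 + d) ^ k" using d by (intro one_le_power) auto
    then have "y * 1 \<le> y * (1 + d) ^ k" using y by (intro mult_left_mono) auto
    then have yz: "y \<le> z" using z(1) by linarith
    have zs: "(imap \<gamma> ^^ Suc (Suc k)) x = imap \<gamma> z" by (simp add: z_def)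
    have "imap \<gamma> z \<le> 1" using imap_left(2)[of z \<gamma>] yz y z assms by auto
    then have le: "(imap \<gamma> ^^ Suc (Suc k)) x \<le> 1/2" using step[of "Suc k"] zs by metis
    have "ln y \<le> ln z" "ln z < 0" using yz y z by auto
    then have "\<bar>ln z\<bar> powr \<beta> \<le> \<bar>ln y\<bar> powr \<beta>" "0 < \<bar>ln z\<bar> powr \<beta>"
      using \<beta> by (auto intro!: powr_mono2)
    then have "d \<le> ln 2 powr \<beta> / \<bar>ln z\<bar> powr \<beta>"
      unfolding d_def using \<open>ln y \<le> ln z\<close> \<open>ln z < 0\<close>
      by (intro divide_left_mono mult_pos_pos) auto
    moreover have "imap \<gamma> z = z * (1 + ln 2 powr \<beta> / \<bar>ln z\<bar> powr \<beta>)"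
      using z by (simp add: imap_def Let_def \<beta>_def)
    ultimately have "z * (1 + d) \<le> imap \<gamma> z"
      using yz y by (simp add: mult_left_mono)
    moreover have "y * (1 + d) ^ k * (1 + d) \<le> z * (1 + d)"
      using z d by (intro mult_right_mono) auto
    ultimately have "y * (1 + d) ^ Suc k \<le> imap \<gamma> z" by (simp add: mult_ac)
    then show ?case using le zs by metis
  qed
  obtain k where "1 / y < (1 + d) ^ k" using real_arch_pow[of "1 + d" "1 / y"] d by auto
  then have "1 < y * (1 + d) ^ k" using y by (simp add: divide_less_eq mult.commute)
  then show False using grow[of k] by linarith
qed

end

theory Submission
  imports Defs
begin

text \<open>
  Let \<open>g\<close> be the left branch and let \<open>1 = z 0 > z 1 > \<dots>\<close> be the successive
  preimages of \<open>1\<close> under \<open>g\<close>. The return time is \<open>n + 1\<close> exactly when \<open>2x - 1\<close> lies in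
  \<open>I n = (z (n + 1), z n]\<close>, and there \<open>F x = g\<^sup>n (2x - 1)\<close>.

  Distortion: with \<open>D n\<close> the derivative of \<open>g\<^sup>n\<close>, it suffices to bound
  \<open>(ln D n)' / D n\<close> on \<open>I n\<close>. Along an orbit \<open>p k\<close> this quotient is a sum of terms
  \<open>g''(p k) / (g' (p k) * D (n - k) (p k))\<close>. As \<open>g\<close> is convex,
  \<open>D (n - k) (p k) \<ge> \<kappa> / (p k - p (k - 1))\<close>, and with \<open>W x = \<bar>ln x\<bar> powr (- \<beta>)\<close> one has
  \<open>g''(p k) * (p k - p (k - 1)) \<le> K * (W (p k) - W (p (k - 1)))\<close>, so the sum telescopes.

  Tails: the set of points with return time at least \<open>n + 1\<close> has measure \<open>z n / 2\<close>, and for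
  \<open>u n = - ln (z n)\<close> the increments of \<open>u n powr (1 / \<gamma>)\<close> lie between two positive constants.
\<close>

section \<open>First return times and nonsingularity for general maps\<close>

lemma return_time_ge_iff:
  assumes "\<exists>k\<ge>1. (f ^^ k) x \<in> Y"
  shows "n \<le> return_time f Y x \<longleftrightarrow> (\<forall>k. 1 \<le> k \<and> k < n \<longrightarrow> (f ^^ k) x \<notin> Y)"
proof -
  let ?S = "{k. k \<ge> 1 \<and> (f ^^ k) x \<in> Y}"
  \<comment> \<open>Nonemptiness makes \<open>Inf\<close> a true minimum instead of the default
    value 0.\<close>
  have ne: "?S \<noteq> {}" using assms by auto
  have "n \<le> Inf ?S \<longleftrightarrow> (\<forall>k\<in>?S. n \<le> k)"
    using ne by (simp add: le_cInf_iff)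
  then show ?thesis
    by (auto simp: return_time_def not_le)
qed

text \<open>Differentiable maps send null sets to null sets. For preimages, expansion makes the
  inverse 1-Lipschitz, and Lipschitz maps preserve null sets as well.\<close>

lemma nonsingular_on_expanding_bij:
  fixes F :: "real \<Rightarrow> real"
  assumes diff: "F differentiable_on a" and bij: "bij_betw F a Y"
    and exp: "\<And>x y. x \<in> a \<Longrightarrow> y \<in> a \<Longrightarrow> \<bar>y - x\<bar> \<le> \<bar>F y - F x\<bar>"
  shows "nonsingular_on F a"
  unfolding nonsingular_on_def
proof (intro ballI conjI)
  fix N assume "N \<in> null_sets (lebesgue :: real measure)"
  then have N: "negligible N" by (simp add: negligible_iff_null_sets)
  have "negligible (F ` (a \<inter> N))"
  proof (rule negligible_differentiable_image_negligible)
    show "negligible (a \<inter> N)" using N by (rule negligible_subset) simp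
    show "F differentiable_on a \<inter> N" using diff by (rule differentiable_on_subset) simp
  qed simp
  then show "F ` (a \<inter> N) \<in> null_sets lebesgue" by (simp add: negligible_iff_null_sets)
  let ?G = "inv_into a F"
  have "negligible (Y \<inter> N)" using N by (rule negligible_subset) simp
  moreover have "\<bar>?G v - ?G w\<bar> \<le> \<bar>v - w\<bar>" if "v \<in> Y" "w \<in> Y" for v w
    using exp[of "?G w" "?G v"] that bij
    by (metis bij_betw_def bij_betw_inv_into_right inv_into_into)
  then have "\<exists>T B. open T \<and> v \<in> T \<and>
      (\<forall>w \<in> (Y \<inter> N) \<inter> T. norm (?G w - ?G v) \<le> B * norm (w - v))"
    if "v \<in> Y \<inter> N" for v
    using that by (intro exI[of _ UNIV] exI[of _ 1]) auto
  ultimately have "negligible (?G ` (Y \<inter> N))"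
    by (intro negligible_locally_Lipschitz_image) auto
  moreover have "a \<inter> F -` N \<subseteq> ?G ` (Y \<inter> N)"
  proof
    fix x assume "x \<in> a \<inter> F -` N"
    then have "x = ?G (F x)" "F x \<in> Y \<inter> N"
      using bij by (auto simp: bij_betw_def)
    then show "x \<in> ?G ` (Y \<inter> N)" by blast
  qed
  ultimately have "negligible (a \<inter> F -` N)" by (rule negligible_subset)
  then show "a \<inter> F -` N \<in> null_sets lebesgue" by (simp add: negligible_iff_null_sets)
qed

section \<open>The left branch: derivatives, convexity and expansion\<close>

locale intermittent_map =
  fixes \<gamma> :: real
  assumes gamma_pos: "0 < \<gamma>" and gamma_le_1: "\<gamma> \<le> 1"
begin

definition \<beta> :: real where "\<beta> = 1 / \<gamma> - 1"

definition c :: real where "c = ln 2 powr \<beta>"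

text \<open>
  The left branch, continued from \<open>(0, 1/2]\<close> to \<open>(0, 1)\<close> so that it has
  two-sided derivatives at \<open>1/2\<close>.
\<close>

definition g :: "real \<Rightarrow> real" where "g x = x * (1 + c * (- ln x) powr (- \<beta>))"

definition dg :: "real \<Rightarrow> real" where
  "dg x = 1 + c * (- ln x) powr (- \<beta>) + c * \<beta> * (- ln x) powr (- \<beta> - 1)"

definition ddg :: "real \<Rightarrow> real" where
  "ddg x = c * \<beta> * ((- ln x) powr (- \<beta> - 1) + (\<beta> + 1) * (- ln x) powr (- \<beta> - 2)) / x"

lemma beta_nonneg: "\<beta> \<ge> 0"
  using gamma_pos gamma_le_1 by (simp add: \<beta>_def)

lemma beta_gamma: "(\<beta> + 1) * \<gamma> = 1"
  using gamma_pos by (simp add: \<beta>_def)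

lemma c_pos: "c > 0"
  by (simp add: c_def)

lemma minus_ln_ge: "0 < x \<Longrightarrow> x \<le> 1/2 \<Longrightarrow> ln 2 \<le> - ln x" for x :: real
  using ln_le_cancel_iff[of x "1/2"] by (simp add: ln_div)

text \<open>The constant \<open>c\<close> normalises the branch:
  \<open>(- ln x) powr (- \<beta>)\<close> is nondecreasing in \<open>x\<close>, and at
  \<open>x = 1/2\<close> the product equals 1.\<close>

lemma c_powr_le_1:
  assumes "0 < x" "x \<le> 1/2"
  shows "c * (- ln x) powr (- \<beta>) \<le> 1"
proof -
  have "(- ln x) powr (- \<beta>) \<le> ln 2 powr (- \<beta>)"
    using minus_ln_ge[OF assms] beta_nonneg by (intro powr_mono2') auto
  then have "c * (- ln x) powr (- \<beta>) \<le> c * ln 2 powr (- \<beta>)"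
    using c_pos by simp
  also have "\<dots> = 1" by (simp add: c_def powr_minus)
  finally show ?thesis .
qed

lemma imap_eq_g:
  assumes "0 < x" "x \<le> 1/2"
  shows "imap \<gamma> x = g x"
proof -
  have "\<bar>ln x\<bar> = - ln x" using assms by simp
  then have "imap \<gamma> x = x * (1 + c / (- ln x) powr \<beta>)"
    using assms by (simp only: imap_def c_def \<beta>_def Let_def if_True)
  then show ?thesis by (simp only: g_def powr_minus divide_inverse)
qed

lemma g_half: "g (1/2) = 1"
  using imap_half[of \<gamma>] imap_eq_g[of "1/2"] by simp

lemma g_gt: "0 < x \<Longrightarrow> x < 1 \<Longrightarrow> x < g x"
  using c_pos by (simp add: g_def)

lemma g_le_double: "0 < x \<Longrightarrow> x \<le> 1/2 \<Longrightarrow> g x \<le> 2 * x"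
  using c_powr_le_1[of x] by (simp add: g_def)

lemma DERIV_minus_ln_powr:
  assumes "0 < x" "x < 1"
  shows "((\<lambda>x. (- ln x) powr a) has_real_derivative - (a * (- ln x) powr (a - 1) / x)) (at x)"
proof -
  have "((\<lambda>x. - ln x) has_real_derivative - (1 / x)) (at x)"
    using assms by (auto intro!: derivative_eq_intros)
  then show ?thesis
    using DERIV_fun_powr[of "\<lambda>x. - ln x" "- (1 / x)" x a] assms by simp
qed

lemma DERIV_g:
  assumes x: "0 < x" "x < 1"
  shows "(g has_real_derivative dg x) (at x)"
proof -
  have "((\<lambda>x. x * (1 + c * (- ln x) powr (- \<beta>))) has_real_derivative
      1 * (1 + c * (- ln x) powr (- \<beta>)) +
      (0 + c * - (- \<beta> * (- ln x) powr (- \<beta> - 1) / x)) * x) (at x)"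
    by (intro DERIV_mult DERIV_add DERIV_cmult DERIV_ident DERIV_const DERIV_minus_ln_powr x)
  then show ?thesis
    using x by (simp add: g_def[abs_def] dg_def mult.assoc)
qed

lemma DERIV_dg:
  assumes x: "0 < x" "x < 1"
  shows "(dg has_real_derivative ddg x) (at x)"
proof -
  have "((\<lambda>x. 1 + c * (- ln x) powr (- \<beta>) + c * \<beta> * (- ln x) powr (- \<beta> - 1))
      has_real_derivative
      0 + c * - (- \<beta> * (- ln x) powr (- \<beta> - 1) / x) +
      c * \<beta> * - ((- \<beta> - 1) * (- ln x) powr (- \<beta> - 1 - 1) / x)) (at x)"
    by (intro DERIV_add DERIV_cmult DERIV_const DERIV_minus_ln_powr x)
  moreover have "- \<beta> - 1 - 1 = - \<beta> - 2" by simp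
  ultimately show ?thesis
    using x by (simp add: dg_def[abs_def] ddg_def field_simps)
qed

lemma dg_ge_1: "0 < x \<Longrightarrow> x < 1 \<Longrightarrow> dg x \<ge> 1"
  using c_pos beta_nonneg by (simp add: dg_def)

lemma ddg_nonneg: "0 < x \<Longrightarrow> x < 1 \<Longrightarrow> ddg x \<ge> 0"
  using c_pos beta_nonneg by (simp add: ddg_def)

lemma dg_mono:
  assumes "0 < x" "x \<le> y" "y < 1"
  shows "dg x \<le> dg y"
  using assms by (intro deriv_nonneg_imp_mono[of x y dg ddg]) (auto intro!: DERIV_dg ddg_nonneg)

text \<open>The function \<open>g t - t\<close> has derivative \<open>dg t - 1 \<ge> 0\<close>. The
  bound later also stands in for strict monotonicity of \<open>g\<close>.\<close>

lemma g_expands: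
  assumes "0 < x" "x \<le> y" "y < 1"
  shows "y - x \<le> g y - g x"
proof -
  have "g x - x \<le> g y - y"
    using assms
    by (intro deriv_nonneg_imp_mono[of x y "\<lambda>t. g t - t" "\<lambda>t. dg t - 1"])
       (auto intro!: DERIV_diff DERIV_g DERIV_ident dg_ge_1)
  then show ?thesis by simp
qed

text \<open>The mean value theorem on \<open>[v, g v]\<close>; by convexity the intermediate slope
  is at most the slope at the right endpoint.\<close>

lemma g_convex_step:
  assumes "0 < v" "v < 1" "g v < 1"
  shows "g (g v) - g v \<le> dg (g v) * (g v - v)"
proof -
  have "v < g v" using assms g_gt by auto
  moreover have "\<And>t. v \<le> t \<Longrightarrow> t \<le> g v \<Longrightarrow> (g has_real_derivative dg t) (at t)"
    using assms by (intro DERIV_g) auto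
  ultimately obtain t where t: "v < t" "t < g v" "g (g v) - g v = (g v - v) * dg t"
    using MVT2[of v "g v" g dg] by auto
  have "dg t \<le> dg (g v)" using t assms by (intro dg_mono) auto
  then show ?thesis using t by (simp add: mult.commute mult_right_mono)
qed

section \<open>Preimages of 1 under the left branch and the intervals between them\<close>

lemma g_preimage:
  assumes "0 < y" "y \<le> 1"
  shows "\<exists>x. 0 < x \<and> x \<le> 1/2 \<and> g x = y"
proof -
  \<comment> \<open>Intermediate values between \<open>y/2\<close> and \<open>1/2\<close>:
    \<open>g (y/2) \<le> y\<close> by \<open>g_le_double\<close>, and
    \<open>g (1/2) = 1 \<ge> y\<close>.\<close>
  have "\<exists>x\<ge>y/2. x \<le> 1/2 \<and> g x = y"
    using assms g_le_double[of "y/2"] g_half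
    by (intro IVT) (auto intro!: DERIV_isCont[OF DERIV_g])
  then obtain x where "y / 2 \<le> x" "x \<le> 1/2" "g x = y" by blast
  then show ?thesis using assms by (intro exI[of _ x]) auto
qed

definition ginv :: "real \<Rightarrow> real" where
  "ginv y = (SOME x. 0 < x \<and> x \<le> 1/2 \<and> g x = y)"

lemma ginv:
  assumes "0 < y" "y \<le> 1"
  shows "0 < ginv y" "ginv y \<le> 1/2" "g (ginv y) = y"
  using someI_ex[OF g_preimage[OF assms]] unfolding ginv_def by auto

definition z :: "nat \<Rightarrow> real" where "z n = (ginv ^^ n) 1"

lemma z_0 [simp]: "z 0 = 1"
  by (simp add: z_def)

lemma z_bounds: "0 < z n" "z n \<le> 1"
proof -
  have "0 < z n \<and> z n \<le> 1"
  proof (induction n)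
    case (Suc n)
    then show ?case using ginv[of "z n"] by (simp add: z_def)
  qed simp
  then show "0 < z n" "z n \<le> 1" by auto
qed

lemma z_Suc: "z (Suc n) \<le> 1/2" "g (z (Suc n)) = z n"
  using ginv[OF z_bounds, of n] by (auto simp: z_def)

lemma z_1: "z (Suc 0) = 1/2"
proof (rule antisym)
  show "1/2 \<le> z (Suc 0)"
    using g_le_double[of "z (Suc 0)"] z_Suc[of 0] z_bounds[of "Suc 0"] by simp
qed (rule z_Suc)

lemma z_le_iff:
  assumes "0 < w" "w \<le> 1/2"
  shows "w \<le> z (Suc n) \<longleftrightarrow> g w \<le> z n"
  using g_expands[of w "z (Suc n)"] g_expands[of "z (Suc n)" w] assms z_Suc[of n]
    z_bounds[of "Suc n"] by linarith

definition I :: "nat \<Rightarrow> real set" where "I n = {z (Suc n)<..z n}"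

lemma I_0: "I 0 = {1/2<..1}"
  by (simp add: I_def z_1)

lemma I_bounds: "w \<in> I n \<Longrightarrow> 0 < w" "w \<in> I n \<Longrightarrow> w \<le> 1"
  using z_bounds[of n] z_bounds[of "Suc n"] by (auto simp: I_def)

lemma I_Suc_le: "w \<in> I (Suc n) \<Longrightarrow> w \<le> 1/2"
  using z_Suc[of n] by (auto simp: I_def)

lemma g_in_I:
  assumes "0 < w" "w \<le> 1/2"
  shows "g w \<in> I n \<longleftrightarrow> w \<in> I (Suc n)"
  using z_le_iff[OF assms, of n] z_le_iff[OF assms, of "Suc n"] by (auto simp: I_def)

lemma g_I: "w \<in> I (Suc n) \<Longrightarrow> g w \<in> I n"
  using g_in_I I_bounds I_Suc_le by blast

lemma I_preimage:
  assumes "w \<in> I n"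
  obtains v where "v \<in> I (Suc n)" "g v = w"
  using g_preimage[of w] I_bounds[OF assms] g_in_I assms by metis

lemma bij_g: "bij_betw g (I (Suc n)) (I n)"
  unfolding bij_betw_def
proof
  show "inj_on g (I (Suc n))"
  proof (rule linorder_inj_onI')
    fix x y assume "x \<in> I (Suc n)" "y \<in> I (Suc n)" "x < y"
    then show "g x \<noteq> g y"
      using g_expands[of x y] I_bounds(1) I_Suc_le[of y n] by fastforce
  qed
  show "g ` I (Suc n) = I n"
    using g_I by (auto elim: I_preimage)
qed

lemma bij_g_funpow: "bij_betw (g ^^ n) (I n) (I 0)"
proof (induction n)
  case (Suc n)
  then show ?case
    using bij_betw_trans[OF bij_g Suc] by (simp only: funpow_Suc_right)
qed (simp add: bij_betw_def)

lemma g_funpow_expands: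
  "x \<in> I n \<Longrightarrow> y \<in> I n \<Longrightarrow> x \<le> y \<Longrightarrow> y - x \<le> (g ^^ n) y - (g ^^ n) x"
proof (induction n arbitrary: x y)
  case (Suc n)
  have "y - x \<le> g y - g x"
    using Suc.prems I_bounds(1) I_Suc_le[of y n] by (intro g_expands) auto
  moreover have "g y - g x \<le> (g ^^ n) (g y) - (g ^^ n) (g x)"
    using Suc.prems calculation by (intro Suc.IH g_I) auto
  ultimately show ?case by (simp add: funpow_Suc_right del: funpow.simps)
qed simp

section \<open>Derivatives of the iterates, unfolded from the first application of \<open>g\<close>
  as in \<open>funpow_Suc_right\<close>\<close>

fun D :: "nat \<Rightarrow> real \<Rightarrow> real" where
  "D 0 w = 1"
| "D (Suc n) w = D n (g w) * dg w"

text \<open>The logarithmic derivative of \<^term>\<open>D n\<close>.\<close>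

fun L :: "nat \<Rightarrow> real \<Rightarrow> real" where
  "L 0 w = 0"
| "L (Suc n) w = ddg w / dg w + L n (g w) * dg w"

lemma D_pos: "w \<in> I n \<Longrightarrow> D n w > 0"
proof (induction n arbitrary: w)
  case (Suc n)
  have "dg w \<ge> 1" using Suc.prems I_bounds(1) I_Suc_le by (force intro!: dg_ge_1)
  then show ?case using Suc by (simp add: g_I)
qed simp

lemma L_nonneg: "w \<in> I n \<Longrightarrow> L n w \<ge> 0"
proof (induction n arbitrary: w)
  case (Suc n)
  have "0 < w" "w < 1" using Suc.prems I_bounds(1) I_Suc_le by force+
  then have "dg w \<ge> 1" "ddg w \<ge> 0" by (auto intro: dg_ge_1 ddg_nonneg)
  then show ?case using Suc by (simp add: g_I)
qed simp

lemma DERIV_g_funpow: "w \<in> I n \<Longrightarrow> ((g ^^ n) has_real_derivative D n w) (at w)"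
proof (induction n arbitrary: w)
  case 0
  show ?case by (simp add: id_def)
next
  case (Suc n)
  have "(g has_real_derivative dg w) (at w)"
    using Suc.prems I_bounds(1) I_Suc_le by (force intro!: DERIV_g)
  then show ?case
    using DERIV_chain[of "g ^^ n" _ g w] Suc.IH[OF g_I[OF Suc.prems]]
    by (simp only: funpow_Suc_right D.simps)
qed

lemma DERIV_D: "w \<in> I n \<Longrightarrow> (D n has_real_derivative D n w * L n w) (at w)"
proof (induction n arbitrary: w)
  case 0
  have "D 0 = (\<lambda>_. 1)" by auto
  then show ?case by simp
next
  case (Suc n)
  have w: "0 < w" "w < 1" using Suc.prems I_bounds(1) I_Suc_le by force+
  have "D (Suc n) = (\<lambda>x. D n (g x) * dg x)" by auto
  moreover have "((\<lambda>x. D n (g x) * dg x) has_real_derivative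
      (D n (g w) * L n (g w) * dg w) * dg w + ddg w * D n (g w)) (at w)"
    by (intro DERIV_mult DERIV_chain2[OF Suc.IH] g_I Suc.prems DERIV_g DERIV_dg w)
  moreover have "D (Suc n) w * L (Suc n) w =
      (D n (g w) * L n (g w) * dg w) * dg w + ddg w * D n (g w)"
    using dg_ge_1[OF w] by (simp add: field_simps)
  ultimately show ?case by simp
qed

subsection \<open>Bounded distortion\<close>

text \<open>This is \<open>g (1/4) - 1/4\<close>, since
  \<open>- ln (1/4) = 2 * ln 2\<close>.\<close>

definition \<kappa> :: real where "\<kappa> = c * (2 * ln 2) powr (- \<beta>) / 4"

text \<open>The middle factor absorbs the second summand of \<open>ddg\<close>; the power of 2 pays
  for replacing \<open>- ln (g v)\<close> by \<open>- ln v\<close>, which is at most twice as large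
  when \<open>g v \<le> 1/2\<close>.\<close>

definition K :: real where "K = c * (1 + (\<beta> + 1) / ln 2) * 2 powr (\<beta> + 1)"

lemma kappa_pos: "\<kappa> > 0"
  using c_pos by (simp add: \<kappa>_def)

lemma K_pos: "K > 0"
  using c_pos beta_nonneg ln_gt_zero[of "2::real"] unfolding K_def
  by (intro mult_pos_pos add_pos_nonneg divide_nonneg_pos) auto

text \<open>From \<open>1/2 < g p \<le> 2 * p\<close> follows \<open>1/4 \<le> p\<close>, and the
  increment \<open>p * c * (- ln p) powr (- \<beta>)\<close> is smallest at
  \<open>1/4\<close>.\<close>

lemma increment_ge:
  assumes "p \<in> I (Suc 0)"
  shows "\<kappa> \<le> g p - p"
proof -
  have p: "0 < p" "p \<le> 1/2" using assms I_bounds I_Suc_le by auto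
  have "1/2 < g p" using g_I[OF assms] by (simp add: I_0)
  then have p4: "1/4 \<le> p" using g_le_double[OF p] by simp
  then have "ln (1/4) \<le> ln p" using p by (subst ln_le_cancel_iff) auto
  moreover have "ln (1/4::real) = - 2 * ln 2"
    using ln_realpow[of 2 2] by (simp add: ln_div)
  ultimately have "- ln p \<le> 2 * ln 2" by simp
  moreover have "0 < - ln p" using minus_ln_ge[OF p] ln_gt_zero[of "2::real"] by linarith
  ultimately have "(2 * ln 2) powr (- \<beta>) \<le> (- ln p) powr (- \<beta>)"
    using beta_nonneg by (intro powr_mono2') auto
  then have "1/4 * (c * (2 * ln 2) powr (- \<beta>)) \<le> p * (c * (- ln p) powr (- \<beta>))"
    using p4 c_pos by (intro mult_mono) auto
  then show ?thesis by (simp add: g_def \<kappa>_def algebra_simps)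
qed

text \<open>
  By \<open>g_convex_step\<close> the derivative along an orbit grows at least as fast as the
  increments \<open>g v - v\<close> do.
\<close>

lemma D_increment_ge:
  "v \<in> I (Suc n) \<Longrightarrow> \<kappa> \<le> D n (g v) * (g v - v)"
proof (induction n arbitrary: v)
  case 0
  then show ?case using increment_ge by simp
next
  case (Suc n)
  have gv: "g v \<in> I (Suc n)" by (rule g_I[OF Suc.prems])
  have "\<kappa> \<le> D n (g (g v)) * (g (g v) - g v)" by (rule Suc.IH[OF gv])
  also have "\<dots> \<le> D n (g (g v)) * (dg (g v) * (g v - v))"
    using D_pos[OF g_I[OF gv]] I_bounds(1)[OF Suc.prems] I_Suc_le[OF Suc.prems] I_Suc_le[OF gv]
    by (intro mult_left_mono g_convex_step) auto
  finally show ?case by (simp add: mult.assoc)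
qed

text \<open>The potential of the telescoping argument: \<open>g x = x * (1 + c * W x)\<close>, and
  \<open>W\<close> lies between 0 and \<open>1 / c\<close> on \<open>(0, 1/2]\<close>.\<close>

definition W :: "real \<Rightarrow> real" where "W x = (- ln x) powr (- \<beta>)"

text \<open>Mean value theorem: the slope of \<open>t powr (- p)\<close> on \<open>[b, a]\<close> is
  smallest in absolute value at \<open>a\<close>.\<close>

lemma powr_minus_diff_ge:
  fixes a b p :: real
  assumes "0 < b" "b < a" "0 \<le> p"
  shows "p * a powr (- p - 1) * (a - b) \<le> b powr (- p) - a powr (- p)"
proof -
  have "((\<lambda>t. t powr (- p)) has_real_derivative - p * t powr (- p - 1)) (at t)" if "b \<le> t" for t
    using that assms by (intro has_real_derivative_powr) auto
  then obtain t where t: "b < t" "t < a"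
      "a powr (- p) - b powr (- p) = (a - b) * (- p * t powr (- p - 1))"
    using MVT2[OF assms(2), of "\<lambda>t. t powr (- p)" "\<lambda>t. - p * t powr (- p - 1)"] by auto
  have "a powr (- p - 1) \<le> t powr (- p - 1)" using t assms by (intro powr_mono2') auto
  then have "p * a powr (- p - 1) * (a - b) \<le> p * t powr (- p - 1) * (a - b)"
    using assms by (intro mult_right_mono mult_left_mono) auto
  then show ?thesis using t(3) by (simp add: algebra_simps)
qed

text \<open>In logarithmic coordinates \<open>a > b\<close>, the left side is at most a constant
  times \<open>\<beta> * b powr (- \<beta> - 1) * (a - b)\<close>. Since
  \<open>a \<le> 2 * b\<close>, this is comparable to the mean value bound for
  \<open>b powr (- \<beta>) - a powr (- \<beta>)\<close>.\<close>

lemma ddg_increment_le: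
  assumes v: "0 < v" "v < 1" and gv: "g v \<le> 1/2"
  shows "ddg (g v) * (g v - v) \<le> K * (W (g v) - W v)"
proof -
  define w where "w = g v"
  define a where "a = - ln v"
  define b where "b = - ln w"
  have w: "v < w" "w \<le> 1/2" "0 < w"
    using g_gt[OF v] gv v by (auto simp: w_def)
  have l2: "0 < ln (2::real)" by simp
  have b: "ln 2 \<le> b" "0 < b" using minus_ln_ge[of w] w l2 unfolding b_def by linarith+
  have ab: "b < a" using w v by (simp add: a_def b_def)
  have "w \<le> 2 * v" using g_le_double[of v] w v by (simp add: w_def)
  then have "ln w \<le> ln (2 * v)" using w v by simp
  \<comment> \<open>Taking logarithms gives \<open>a \<le> b + ln 2\<close>, and
    \<open>ln 2 \<le> b\<close>.\<close>
  then have "a \<le> 2 * b" using b v by (simp add: a_def b_def ln_mult)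
  have "(w - v) / w \<le> a - b"
  proof -
    have "ln (v / w) \<le> v / w - 1" using v w by (intro ln_le_minus_one) auto
    then show ?thesis using v w by (simp add: a_def b_def ln_div diff_divide_distrib)
  qed
  moreover have "b powr (- \<beta> - 1) + (\<beta> + 1) * b powr (- \<beta> - 2)
      \<le> (1 + (\<beta> + 1) / ln 2) * b powr (- \<beta> - 1)"
  proof -
    have "b powr (- \<beta> - 2) = b powr (- \<beta> - 1) / b"
      using b powr_diff[of b "- \<beta> - 1" 1] by (simp add: algebra_simps)
    also have "\<dots> \<le> b powr (- \<beta> - 1) / ln 2"
      by (intro divide_left_mono mult_pos_pos b l2) auto
    finally have "(\<beta> + 1) * b powr (- \<beta> - 2) \<le> (\<beta> + 1) * (b powr (- \<beta> - 1) / ln 2)"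
      using beta_nonneg by (intro mult_left_mono) auto
    then show ?thesis by (simp add: algebra_simps)
  qed
  ultimately have "(b powr (- \<beta> - 1) + (\<beta> + 1) * b powr (- \<beta> - 2)) * ((w - v) / w)
      \<le> ((1 + (\<beta> + 1) / ln 2) * b powr (- \<beta> - 1)) * (a - b)"
    using w beta_nonneg by (intro mult_mono) auto
  then have "c * \<beta> * ((b powr (- \<beta> - 1) + (\<beta> + 1) * b powr (- \<beta> - 2)) * ((w - v) / w))
      \<le> c * \<beta> * (((1 + (\<beta> + 1) / ln 2) * b powr (- \<beta> - 1)) * (a - b))"
    using c_pos beta_nonneg by (intro mult_left_mono) auto
  \<comment> \<open>Rescaling to \<open>2 * b\<close> prepares the comparison with \<open>a\<close>,
    as the exponent is negative.\<close>
  also have "\<dots> = K * (\<beta> * (2 * b) powr (- \<beta> - 1) * (a - b))"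
  proof -
    have "2 powr (\<beta> + 1) * (2 * b) powr (- \<beta> - 1)
        = (2 powr (\<beta> + 1) * 2 powr (- \<beta> - 1)) * b powr (- \<beta> - 1)"
      using b by (simp add: powr_mult)
    also have "2 powr (\<beta> + 1) * 2 powr (- \<beta> - 1) = (1::real)"
      by (simp add: powr_add[symmetric])
    finally have "b powr (- \<beta> - 1) = 2 powr (\<beta> + 1) * (2 * b) powr (- \<beta> - 1)" by simp
    then show ?thesis by (simp add: K_def)
  qed
  also have "\<dots> \<le> K * (\<beta> * a powr (- \<beta> - 1) * (a - b))"
    using K_pos beta_nonneg ab b \<open>a \<le> 2 * b\<close>
    by (intro mult_left_mono mult_right_mono powr_mono2') auto
  also have "\<dots> \<le> K * (b powr (- \<beta>) - a powr (- \<beta>))"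
    using K_pos powr_minus_diff_ge[OF b(2) ab beta_nonneg] by (intro mult_left_mono) auto
  finally show ?thesis
    by (simp add: ddg_def W_def a_def b_def w_def mult.assoc)
qed

text \<open>The telescoping sum in inductive form: \<open>1 / c - W v\<close> bounds what
  \<open>W\<close> can still gain before the orbit passes \<open>1/2\<close>. The bound is indexed
  by a preimage \<open>v\<close> because \<open>ddg_increment_le\<close> controls the term at
  \<open>g v\<close> through the step from \<open>v\<close>.\<close>

lemma L_le:
  "v \<in> I (Suc n) \<Longrightarrow> L n (g v) \<le> K / \<kappa> * (1 / c - W v) * D n (g v)"
proof (induction n arbitrary: v)
  case 0
  have "c * W v \<le> 1" unfolding W_def
    using 0 I_bounds(1) I_Suc_le by (intro c_powr_le_1) auto
  then have "W v \<le> 1 / c" using c_pos by (simp add: field_simps)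
  then show ?case using K_pos kappa_pos by simp
next
  case (Suc n)
  have gv: "g v \<in> I (Suc n)" by (rule g_I[OF Suc.prems])
  have v: "0 < v" "v < 1" "g v \<le> 1/2" "0 < g v" "v < g v"
    using I_bounds(1)[OF Suc.prems] I_Suc_le[OF Suc.prems] I_Suc_le[OF gv] I_bounds(1)[OF gv]
      g_gt[of v] by auto
  note dg = dg_ge_1[OF v(4)] and D = D_pos[OF gv]
  have "ddg (g v) / dg (g v) \<le> ddg (g v)"
    using dg v ddg_nonneg[of "g v"] by (simp add: divide_le_eq mult_le_cancel_left1)
  also have "\<dots> \<le> K / \<kappa> * (W (g v) - W v) * D (Suc n) (g v)"
  proof -
    have "ddg (g v) * \<kappa> \<le> ddg (g v) * (D (Suc n) (g v) * (g v - v))"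
      using D_increment_ge[OF Suc.prems] ddg_nonneg[of "g v"] v by (intro mult_left_mono) auto
    also have "\<dots> = ddg (g v) * (g v - v) * D (Suc n) (g v)" by simp
    also have "\<dots> \<le> K * (W (g v) - W v) * D (Suc n) (g v)"
      using ddg_increment_le[OF v(1-3)] D by (intro mult_right_mono) auto
    finally show ?thesis using kappa_pos by (simp add: field_simps)
  qed
  finally have "ddg (g v) / dg (g v) \<le> K / \<kappa> * (W (g v) - W v) * D (Suc n) (g v)" .
  moreover have "L n (g (g v)) * dg (g v) \<le> K / \<kappa> * (1 / c - W (g v)) * D (Suc n) (g v)"
    using mult_right_mono[OF Suc.IH[OF gv], of "dg (g v)"] dg v by (simp add: mult.assoc)
  \<comment> \<open>The two occurrences of \<open>W (g v)\<close> cancel.\<close>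
  ultimately have "L (Suc n) (g v) \<le> K / \<kappa> * (W (g v) - W v) * D (Suc n) (g v)
      + K / \<kappa> * (1 / c - W (g v)) * D (Suc n) (g v)"
    by simp
  then show ?case by (simp only: algebra_simps)
qed

definition C :: real where "C = K / \<kappa> / c"

lemma C_pos: "C > 0"
  using K_pos kappa_pos c_pos by (simp add: C_def)

lemma L_le_C_D:
  assumes "w \<in> I n"
  shows "L n w \<le> C * D n w"
proof -
  obtain v where v: "v \<in> I (Suc n)" "g v = w" using assms by (rule I_preimage)
  have "L n w \<le> K / \<kappa> * (1 / c - W v) * D n w" using L_le[OF v(1)] v(2) by simp
  also have "\<dots> \<le> K / \<kappa> * (1 / c) * D n w"
    using K_pos kappa_pos D_pos[OF assms]
    by (intro mult_right_mono mult_left_mono) (auto simp: W_def)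
  finally show ?thesis by (simp add: C_def)
qed

text \<open>Both \<open>ln (D n t)\<close> and \<open>C * (g ^^ n) t - ln (D n t)\<close> are
  nondecreasing: their derivatives are \<open>L n\<close> and \<open>C * D n - L n\<close>, with
  signs from \<open>L_nonneg\<close> and \<open>L_le_C_D\<close>.\<close>

lemma distortion_ordered:
  assumes "x \<in> I n" "y \<in> I n" "x \<le> y"
  shows "0 \<le> ln (D n y) - ln (D n x)"
    and "ln (D n y) - ln (D n x) \<le> C * ((g ^^ n) y - (g ^^ n) x)"
proof -
  have I: "t \<in> I n" if "t \<in> {x..y}" for t using that assms by (auto simp: I_def)
  have ln_D: "((\<lambda>t. ln (D n t)) has_real_derivative L n t) (at t)" if "t \<in> {x..y}" for t
  proof -
    note D = D_pos[OF I[OF that]]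
    show ?thesis
      using DERIV_chain2[OF DERIV_ln[OF D] DERIV_D[OF I[OF that]]] D by (simp add: field_simps)
  qed
  have "ln (D n x) \<le> ln (D n y)"
    using assms(3) by (intro deriv_nonneg_imp_mono[of x y "\<lambda>t. ln (D n t)" "L n"] ln_D L_nonneg I)
  then show "0 \<le> ln (D n y) - ln (D n x)" by simp
  have "((\<lambda>t. C * (g ^^ n) t - ln (D n t)) has_real_derivative C * D n t - L n t) (at t)"
    if "t \<in> {x..y}" for t
    using that by (intro DERIV_diff DERIV_cmult DERIV_g_funpow ln_D I)
  moreover have "C * D n t - L n t \<ge> 0" if "t \<in> {x..y}" for t
    using L_le_C_D[OF I[OF that]] by simp
  ultimately have "C * (g ^^ n) x - ln (D n x) \<le> C * (g ^^ n) y - ln (D n y)"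
    using assms(3) by (rule deriv_nonneg_imp_mono)
  then show "ln (D n y) - ln (D n x) \<le> C * ((g ^^ n) y - (g ^^ n) x)"
    by (simp add: algebra_simps)
qed

lemma distortion:
  assumes "x \<in> I n" "y \<in> I n"
  shows "\<bar>ln (D n y) - ln (D n x)\<bar> \<le> C * \<bar>(g ^^ n) y - (g ^^ n) x\<bar>"
proof (cases "x \<le> y")
  case True
  then show ?thesis
    using distortion_ordered[OF assms True] g_funpow_expands[OF assms True] by simp
next
  case False
  then have "y \<le> x" by simp
  then show ?thesis
    using distortion_ordered[OF assms(2,1)] g_funpow_expands[OF assms(2,1)]
    by (simp add: abs_minus_commute)
qed

subsection \<open>Return times\<close>

lemma imap_base: "x \<in> base \<Longrightarrow> imap \<gamma> x = 2 * x - 1"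
  by (simp add: imap_def base_def)

lemma imap_bounds:
  assumes "0 < x" "x \<le> 1"
  shows "0 < imap \<gamma> x" "imap \<gamma> x \<le> 1"
  using imap_left[of x \<gamma>] imap_base[of x] assms gamma_pos gamma_le_1
  by (cases "x \<le> 1/2"; auto simp: base_def)+

lemma imap_funpow_bounds:
  assumes "0 < x" "x \<le> 1"
  shows "0 < (imap \<gamma> ^^ k) x \<and> (imap \<gamma> ^^ k) x \<le> 1"
  by (induction k) (auto simp: assms imap_bounds)

text \<open>As long as the orbit stays at most \<open>1/2\<close> the map is \<open>g\<close>, and
  \<open>g\<close> carries the threshold \<open>z (Suc n)\<close> to \<open>z n\<close>.\<close>

lemma stays_left_iff:
  "0 < w \<Longrightarrow> w \<le> 1 \<Longrightarrow> (\<forall>k<n. (imap \<gamma> ^^ k) w \<le> 1/2) \<longleftrightarrow> w \<le> z n"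
proof (induction n arbitrary: w)
  case (Suc n)
  have "(\<forall>k<Suc n. (imap \<gamma> ^^ k) w \<le> 1/2) \<longleftrightarrow>
      w \<le> 1/2 \<and> (\<forall>k<n. (imap \<gamma> ^^ k) (imap \<gamma> w) \<le> 1/2)"
    by (simp add: All_less_Suc2 funpow_swap1)
  also have "\<dots> \<longleftrightarrow> w \<le> 1/2 \<and> imap \<gamma> w \<le> z n"
    using Suc.IH[of "imap \<gamma> w"] imap_bounds[OF Suc.prems] by blast
  also have "\<dots> \<longleftrightarrow> w \<le> z (Suc n)"
    using z_le_iff[OF Suc.prems(1), of n] z_Suc[of n] imap_eq_g[OF Suc.prems(1)] by fastforce
  finally show ?case .
qed simp

abbreviation \<tau> :: "real \<Rightarrow> nat" where "\<tau> \<equiv> return_time (imap \<gamma>) base"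

text \<open>The first step uses the right branch and lands at \<open>2 * x - 1\<close>; the
  \<open>n\<close> orbit points from there on must avoid the base, which
  \<open>stays_left_iff\<close> decides.\<close>

lemma Suc_le_return_time_iff:
  assumes "x \<in> base"
  shows "Suc n \<le> \<tau> x \<longleftrightarrow> 2 * x - 1 \<le> z n"
proof -
  have x: "0 < 2 * x - 1" "2 * x - 1 \<le> 1" using assms by (auto simp: base_def)
  have "Suc n \<le> \<tau> x \<longleftrightarrow> (\<forall>k. 1 \<le> k \<and> k < Suc n \<longrightarrow> (imap \<gamma> ^^ k) x \<notin> base)"
    using imap_returns[OF gamma_pos gamma_le_1 assms] by (rule return_time_ge_iff)
  also have "\<dots> \<longleftrightarrow> (\<forall>k<n. (imap \<gamma> ^^ Suc k) x \<notin> base)"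
    by (auto simp del: funpow.simps elim: allE[of _ "Suc _"]) (metis Suc_le_D Suc_less_eq One_nat_def)
  also have "\<dots> \<longleftrightarrow> (\<forall>k<n. (imap \<gamma> ^^ k) (2 * x - 1) \<notin> base)"
    by (simp only: funpow_Suc_right comp_def imap_base[OF assms])
  also have "\<dots> \<longleftrightarrow> (\<forall>k<n. (imap \<gamma> ^^ k) (2 * x - 1) \<le> 1/2)"
    using imap_funpow_bounds[OF x] by (auto simp: base_def)
  also have "\<dots> \<longleftrightarrow> 2 * x - 1 \<le> z n" by (rule stays_left_iff[OF x])
  finally show ?thesis .
qed

lemma return_time_eq_iff:
  assumes "x \<in> base"
  shows "\<tau> x = Suc n \<longleftrightarrow> 2 * x - 1 \<in> I n"
  using Suc_le_return_time_iff[OF assms, of n] Suc_le_return_time_iff[OF assms, of "Suc n"]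
  by (auto simp: I_def)

lemma return_time_pos: "x \<in> base \<Longrightarrow> \<tau> x \<noteq> 0"
  using Suc_le_return_time_iff[of x 0] by (auto simp: base_def)

text \<open>Each nonempty level set of the return time is already an interval, hence its own only
  component.\<close>

lemma return_partition_elim:
  assumes "a \<in> return_partition (imap \<gamma>) base"
  obtains n where "a = {x. 2 * x - 1 \<in> I n}"
proof -
  obtain m where a: "a \<in> components {x \<in> base. \<tau> x = m}"
    using assms by (auto simp: return_partition_def)
  then obtain x where "x \<in> base" "\<tau> x = m"
    using in_components_nonempty in_components_subset by fastforce
  then obtain n where m: "m = Suc n" using return_time_pos by (cases m) auto
  have S: "{x \<in> base. \<tau> x = m} = {x. 2 * x - 1 \<in> I n}"
    using return_time_eq_iff[of _ n] I_bounds[of _ n] by (force simp: m base_def)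
  have "{x. 2 * x - 1 \<in> I n} = {(1 + z (Suc n)) / 2 <.. (1 + z n) / 2}"
    by (auto simp: I_def field_simps)
  then have "connected {x. 2 * x - 1 \<in> I n}" by simp
  then have "a = {x. 2 * x - 1 \<in> I n}"
    using a unfolding S connected_eq_components_subset_sing by blast
  then show thesis by (rule that)
qed

lemma imap_funpow_eq: "w \<in> I n \<Longrightarrow> (imap \<gamma> ^^ n) w = (g ^^ n) w"
proof (induction n arbitrary: w)
  case (Suc n)
  then have "imap \<gamma> w = g w" using I_bounds(1) I_Suc_le imap_eq_g by blast
  then show ?case
    using Suc.IH[OF g_I[OF Suc.prems]] by (simp only: funpow_Suc_right comp_def)
qed simp

lemma induced_map_eq:
  assumes "2 * x - 1 \<in> I n"
  shows "induced_map (imap \<gamma>) base x = (g ^^ n) (2 * x - 1)"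
proof -
  have x: "x \<in> base" using I_bounds[OF assms] by (simp add: base_def)
  then have "\<tau> x = Suc n" using return_time_eq_iff assms by blast
  then show ?thesis
    using imap_funpow_eq[OF assms]
    by (simp only: induced_map_def funpow_Suc_right comp_def imap_base[OF x])
qed

subsection \<open>Tails of the return time\<close>

definition u :: "nat \<Rightarrow> real" where "u n = - ln (z n)"

lemma u_0: "u 0 = 0" by (simp add: u_def)

lemma u_nonneg: "u n \<ge> 0"
  using z_bounds[of n] by (simp add: u_def)

lemma u_Suc_ge: "ln 2 \<le> u (Suc n)"
  unfolding u_def using z_bounds z_Suc by (intro minus_ln_ge) auto

lemma u_Suc_pos: "0 < u (Suc n)"
  using u_Suc_ge[of n] ln_gt_zero[of "2::real"] by linarith

text \<open>In logarithmic coordinates the step is \<open>ln (1 + q n)\<close> with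
  \<open>0 < q n \<le> 1\<close>, and
  \<open>q / 2 \<le> q / (1 + q) \<le> ln (1 + q) \<le> q\<close>.\<close>

lemma u_step:
  defines "q \<equiv> \<lambda>n. c * u (Suc n) powr (- \<beta>)"
  shows "q n / 2 \<le> u (Suc n) - u n" "u (Suc n) - u n \<le> q n"
proof -
  have q: "0 < q n" "q n \<le> 1"
    using c_powr_le_1[of "z (Suc n)"] z_bounds[of "Suc n"] z_Suc[of n] c_pos u_Suc_pos[of n]
    by (auto simp: q_def u_def)
  have "z n = z (Suc n) * (1 + q n)"
    using z_Suc(2)[of n] by (simp add: g_def q_def u_def)
  then have "ln (z n) = ln (z (Suc n)) + ln (1 + q n)"
    using q z_bounds[of "Suc n"] by (simp add: ln_mult)
  then have e: "u (Suc n) - u n = ln (1 + q n)" by (simp add: u_def)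
  show "u (Suc n) - u n \<le> q n" unfolding e using q by (intro ln_add_one_self_le_self) auto
  have "q n / 2 \<le> q n / (1 + q n)" using q by (intro divide_left_mono) auto
  also have "\<dots> \<le> ln (1 + q n)"
    using ln_le_minus_one[of "1 / (1 + q n)"] q by (simp add: ln_div field_simps)
  finally show "q n / 2 \<le> u (Suc n) - u n" unfolding e .
qed

text \<open>Mean value theorem with the slope bounded at \<open>a\<close>. The case
  \<open>b = 0\<close>, needed for \<open>u 0 = 0\<close>, is separate because the power rule is
  applied only at positive points.\<close>

lemma powr_diff_le:
  fixes a b p :: real
  assumes "0 \<le> b" "b < a" "0 \<le> p"
  shows "a powr (p + 1) - b powr (p + 1) \<le> (p + 1) * (a powr p * (a - b))"
proof (cases "b = 0")
  case True
  have "1 * (a powr p * a) \<le> (p + 1) * (a powr p * a)"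
    using assms by (intro mult_right_mono) auto
  then show ?thesis using True assms by (simp add: powr_add)
next
  case False
  have "((\<lambda>t. t powr (p + 1)) has_real_derivative (p + 1) * t powr p) (at t)" if "b \<le> t" for t
    using that assms False has_real_derivative_powr[of t "p + 1"] by simp
  then obtain t where t: "b < t" "t < a"
      "a powr (p + 1) - b powr (p + 1) = (a - b) * ((p + 1) * t powr p)"
    using MVT2[OF assms(2), of "\<lambda>t. t powr (p + 1)" "\<lambda>t. (p + 1) * t powr p"] by auto
  have "t powr p \<le> a powr p" using t assms by (intro powr_mono2) auto
  then have "(p + 1) * (t powr p * (a - b)) \<le> (p + 1) * (a powr p * (a - b))"
    using assms by (intro mult_left_mono mult_right_mono) auto
  then show ?thesis using t(3) by (simp add: mult_ac)
qed

text \<open>The exponent \<open>\<beta> + 1 = 1 / \<gamma>\<close> is the one for which the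
  derivative factor \<open>a powr \<beta>\<close> cancels the step size
  \<open>c * a powr (- \<beta>)\<close>.\<close>

lemma u_powr_step:
  shows "c / 2 \<le> u (Suc n) powr (\<beta> + 1) - u n powr (\<beta> + 1)"
    and "u (Suc n) powr (\<beta> + 1) - u n powr (\<beta> + 1) \<le> (\<beta> + 1) * c"
proof -
  define a where "a = u (Suc n)"
  define b where "b = u n"
  have a: "a > 0" using u_Suc_pos by (simp add: a_def)
  have b: "b \<ge> 0" using u_nonneg by (simp add: b_def)
  have aq: "a powr \<beta> * (c * a powr (- \<beta>)) = c"
    using a by (simp add: powr_minus)
  have step: "c * a powr (- \<beta>) / 2 \<le> a - b" "a - b \<le> c * a powr (- \<beta>)"
    using u_step[of n] by (auto simp: a_def b_def)
  have "0 < c * a powr (- \<beta>)" using a c_pos by simp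
  then have ab: "b < a" using step by linarith
  have "c / 2 = a powr \<beta> * (c * a powr (- \<beta>) / 2)" using aq by simp
  also have "\<dots> \<le> a powr \<beta> * (a - b)" using step by (intro mult_left_mono) auto
  also have "\<dots> = a powr (\<beta> + 1) - a powr \<beta> * b"
    using a by (simp add: powr_add algebra_simps)
  also have "\<dots> \<le> a powr (\<beta> + 1) - b powr \<beta> * b"
    using ab b beta_nonneg by (intro diff_left_mono mult_right_mono powr_mono2) auto
  also have "b powr \<beta> * b = b powr (\<beta> + 1)" using b by (simp add: powr_add)
  finally show "c / 2 \<le> u (Suc n) powr (\<beta> + 1) - u n powr (\<beta> + 1)"
    by (simp add: a_def b_def)
  have "a powr (\<beta> + 1) - b powr (\<beta> + 1) \<le> (\<beta> + 1) * (a powr \<beta> * (a - b))"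
    by (rule powr_diff_le[OF b ab beta_nonneg])
  also have "\<dots> \<le> (\<beta> + 1) * (a powr \<beta> * (c * a powr (- \<beta>)))"
    using step beta_nonneg by (intro mult_left_mono) auto
  also have "\<dots> = (\<beta> + 1) * c" by (simp only: aq)
  finally show "u (Suc n) powr (\<beta> + 1) - u n powr (\<beta> + 1) \<le> (\<beta> + 1) * c"
    by (simp only: a_def b_def)
qed

lemma u_powr_bounds:
  "c / 2 * n \<le> u n powr (\<beta> + 1) \<and> u n powr (\<beta> + 1) \<le> (\<beta> + 1) * c * n"
proof (induction n)
  case (Suc n)
  then show ?case using u_powr_step[of n] by (simp add: algebra_simps)
qed (simp add: u_0)

lemma u_bounds:
  shows "(c / 2) powr \<gamma> * real n powr \<gamma> \<le> u n"
    and "u n \<le> ((\<beta> + 1) * c) powr \<gamma> * real n powr \<gamma>"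
proof -
  have e: "u n = (u n powr (\<beta> + 1)) powr \<gamma>"
    using u_nonneg[of n] by (simp add: powr_powr beta_gamma)
  have "(c / 2 * n) powr \<gamma> \<le> (u n powr (\<beta> + 1)) powr \<gamma>"
    using u_powr_bounds[of n] gamma_pos c_pos by (intro powr_mono2) auto
  then show "(c / 2) powr \<gamma> * real n powr \<gamma> \<le> u n"
    unfolding e[symmetric] using c_pos by (simp only: powr_mult)
  have "(u n powr (\<beta> + 1)) powr \<gamma> \<le> ((\<beta> + 1) * c * n) powr \<gamma>"
    using u_powr_bounds[of n] gamma_pos by (intro powr_mono2) auto
  then show "u n \<le> ((\<beta> + 1) * c) powr \<gamma> * real n powr \<gamma>"
    unfolding e[symmetric] using c_pos beta_nonneg by (simp only: powr_mult)
qed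

lemma measure_return_time_ge:
  "measure lebesgue {x \<in> base. Suc n \<le> \<tau> x} = z n / 2"
proof -
  have "{x \<in> base. Suc n \<le> \<tau> x} = {1/2 <.. (1 + z n) / 2}"
    using Suc_le_return_time_iff[of _ n] z_bounds[of n] by (force simp: base_def field_simps)
  then show ?thesis using z_bounds[of n] by (simp add: field_simps)
qed

text \<open>The measure is \<open>exp (- (u n + ln 2))\<close>. Both
  \<open>u n \<le> u (Suc n)\<close> and \<open>u (Suc n) \<le> u n + ln 2\<close> hold, so
  \<open>u_bounds\<close> can be used at \<open>Suc n\<close>.\<close>

lemma tail_bounds:
  shows "exp (- (((\<beta> + 1) * c) powr \<gamma> + ln 2) * real (Suc n) powr \<gamma>)
      \<le> measure lebesgue {x \<in> base. Suc n \<le> \<tau> x}" (is ?lower)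
    and "measure lebesgue {x \<in> base. Suc n \<le> \<tau> x}
      \<le> exp (- ((c / 2) powr \<gamma>) * real (Suc n) powr \<gamma>)" (is ?upper)
proof -
  have z: "z n / 2 = exp (- (u n + ln 2))"
    using z_bounds[of n] by (simp add: u_def exp_diff)
  have "u n \<le> u (Suc n)"
    using u_step(1)[of n] c_pos by (smt (verit) divide_nonneg_pos mult_nonneg_nonneg powr_ge_zero)
  \<comment> \<open>The factor \<open>1/2\<close> in the measure is absorbed into the exponent, as
    \<open>real (Suc n) powr \<gamma> \<ge> 1\<close>.\<close>
  moreover have "ln 2 * 1 \<le> ln 2 * real (Suc n) powr \<gamma>"
    using gamma_pos by (intro mult_left_mono ge_one_powr_ge_zero) auto
  ultimately have "u n + ln 2 \<le> (((\<beta> + 1) * c) powr \<gamma> + ln 2) * real (Suc n) powr \<gamma>"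
    using u_bounds(2)[of "Suc n"] by (simp only: distrib_right)
  then show ?lower
    unfolding measure_return_time_ge z exp_le_cancel_iff by (simp only: mult_minus_left neg_le_iff_le)
  have "u (Suc n) \<le> u n + ln 2"
  proof -
    have "z n \<le> 2 * z (Suc n)" using g_le_double[of "z (Suc n)"] z_bounds[of "Suc n"] z_Suc[of n] by simp
    then have "ln (z n) \<le> ln (2 * z (Suc n))" using z_bounds[of n] by simp
    then show ?thesis using z_bounds[of "Suc n"] by (simp add: u_def ln_mult)
  qed
  then have "(c / 2) powr \<gamma> * real (Suc n) powr \<gamma> \<le> u n + ln 2"
    using u_bounds(1)[of "Suc n"] by simp
  then show ?upper
    unfolding measure_return_time_ge z exp_le_cancel_iff by (simp only: mult_minus_left neg_le_iff_le)
qed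

subsection \<open>The induced map\<close>

abbreviation F :: "real \<Rightarrow> real" where "F \<equiv> induced_map (imap \<gamma>) base"

context
  fixes n :: nat and a :: "real set"
  defines a_def: "a \<equiv> {x. 2 * x - 1 \<in> I n}"
begin

text \<open>The function \<open>(g ^^ n) (2 * x - 1)\<close> has a two-sided derivative even at the
  right endpoint of \<open>a\<close>, thanks to the continuation of \<open>g\<close>. Its agreement
  with \<open>F\<close> is known on \<open>a\<close>, hence the derivative within
  \<open>a\<close>.\<close>

lemma DERIV_F:
  assumes "x \<in> a"
  shows "(F has_real_derivative 2 * D n (2 * x - 1)) (at x within a)"
proof -
  have "((\<lambda>x. 2 * x - 1) has_real_derivative 2) (at x)"
    by (auto intro!: derivative_eq_intros)
  then have "((\<lambda>x. (g ^^ n) (2 * x - 1)) has_real_derivative D n (2 * x - 1) * 2) (at x)"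
    using assms by (intro DERIV_chain2[OF DERIV_g_funpow]) (simp_all add: a_def)
  then have "((\<lambda>x. (g ^^ n) (2 * x - 1)) has_real_derivative 2 * D n (2 * x - 1)) (at x within a)"
    by (simp add: mult.commute DERIV_subset[of _ _ _ UNIV])
  then show ?thesis
    by (rule has_field_derivative_transform_within[OF _ zero_less_one assms])
       (simp add: induced_map_eq a_def)
qed

lemma bij_F: "bij_betw F a base"
proof -
  have "bij_betw (\<lambda>x. 2 * x - 1) a (I n)"
    by (rule bij_betw_byWitness[where f' = "\<lambda>w. (w + 1) / 2"]) (auto simp: a_def add_divide_distrib)
  then have "bij_betw ((g ^^ n) \<circ> (\<lambda>x. 2 * x - 1)) a (I 0)"
    by (rule bij_betw_trans[OF _ bij_g_funpow])
  then show ?thesis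
    by (subst bij_betw_cong[of a F "(g ^^ n) \<circ> (\<lambda>x. 2 * x - 1)"])
       (auto simp: a_def induced_map_eq I_0 base_def[symmetric])
qed

text \<open>The factor 2 is the slope of the right branch; the iterates of \<open>g\<close> do not
  contract.\<close>

lemma F_expands:
  assumes "x \<in> a" "y \<in> a"
  shows "2 * \<bar>y - x\<bar> \<le> \<bar>F y - F x\<bar>"
  using g_funpow_expands[of "2 * x - 1" n "2 * y - 1"] g_funpow_expands[of "2 * y - 1" n "2 * x - 1"]
    assms by (auto simp: a_def induced_map_eq abs_if)

lemma nonsingular_F: "nonsingular_on F a"
proof (rule nonsingular_on_expanding_bij[OF _ bij_F])
  show "F differentiable_on a"
    unfolding differentiable_on_def
    using DERIV_F by (auto simp: real_differentiable_def)
  show "\<bar>y - x\<bar> \<le> \<bar>F y - F x\<bar>" if "x \<in> a" "y \<in> a" for x y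
    by (rule order_trans[OF _ F_expands[OF that]]) simp
qed

lemma F_distortion:
  assumes "x \<in> a" "y \<in> a"
  shows "\<bar>ln (2 * D n (2 * y - 1)) - ln (2 * D n (2 * x - 1))\<bar> \<le> C * \<bar>F y - F x\<bar>"
  using distortion[of "2 * x - 1" n "2 * y - 1"] assms
    D_pos[of "2 * x - 1" n] D_pos[of "2 * y - 1" n]
  by (simp add: a_def induced_map_eq ln_mult)

end

end

theorem theoremA1:
  fixes \<gamma> :: real
  assumes "0 < \<gamma>" and "\<gamma> \<le> 1"
  shows "(\<exists>C>0. \<forall>a \<in> return_partition (imap \<gamma>) base.
            nonsingular_on (induced_map (imap \<gamma>) base) a \<and>
            bij_betw (induced_map (imap \<gamma>) base) a base \<and>
            (\<forall>x\<in>a. \<forall>y\<in>a.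
               \<bar>induced_map (imap \<gamma>) base y - induced_map (imap \<gamma>) base x\<bar> \<ge> 2 * \<bar>y - x\<bar>) \<and>
            (\<exists>F'. (\<forall>x\<in>a. (induced_map (imap \<gamma>) base has_real_derivative F' x) (at x within a) \<and>
                          F' x > 0) \<and>
                  (\<forall>x\<in>a. \<forall>y\<in>a.
                     \<bar>ln (F' y) - ln (F' x)\<bar>
                       \<le> C * \<bar>induced_map (imap \<gamma>) base y - induced_map (imap \<gamma>) base x\<bar>))) \<and>
         (\<exists>\<eta>1>0. \<exists>\<eta>2>0. \<forall>n\<ge>1.
            exp (- \<eta>2 * real n powr \<gamma>)
              \<le> measure lebesgue {x \<in> base. return_time (imap \<gamma>) base x \<ge> n} \<and>
            measure lebesgue {x \<in> base. return_time (imap \<gamma>) base x \<ge> n}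
              \<le> exp (- \<eta>1 * real n powr \<gamma>))"
proof -
  interpret intermittent_map \<gamma> using assms by unfold_locales
  \<comment> \<open>The constant \<open>C\<close> depends on \<open>\<gamma>\<close> alone, so it
    serves every \<open>n\<close> and thus every partition element.\<close>
  have "\<exists>F'. (\<forall>x\<in>a. (F has_real_derivative F' x) (at x within a) \<and> F' x > 0) \<and>
      (\<forall>x\<in>a. \<forall>y\<in>a. \<bar>ln (F' y) - ln (F' x)\<bar> \<le> C * \<bar>F y - F x\<bar>)"
    if "a = {x. 2 * x - 1 \<in> I n}" for a n
    using DERIV_F[of _ n] F_distortion[of _ n] D_pos[of _ n] unfolding that
    by (intro exI[of _ "\<lambda>x. 2 * D n (2 * x - 1)"]) auto
  then have "\<forall>a \<in> return_partition (imap \<gamma>) base.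
      nonsingular_on F a \<and> bij_betw F a base \<and>
      (\<forall>x\<in>a. \<forall>y\<in>a. \<bar>F y - F x\<bar> \<ge> 2 * \<bar>y - x\<bar>) \<and>
      (\<exists>F'. (\<forall>x\<in>a. (F has_real_derivative F' x) (at x within a) \<and> F' x > 0) \<and>
        (\<forall>x\<in>a. \<forall>y\<in>a. \<bar>ln (F' y) - ln (F' x)\<bar> \<le> C * \<bar>F y - F x\<bar>))"
    using nonsingular_F bij_F F_expands by (metis return_partition_elim)
  moreover have "exp (- (((\<beta> + 1) * c) powr \<gamma> + ln 2) * real n powr \<gamma>)
        \<le> measure lebesgue {x \<in> base. \<tau> x \<ge> n} \<and>
      measure lebesgue {x \<in> base. \<tau> x \<ge> n} \<le> exp (- ((c / 2) powr \<gamma>) * real n powr \<gamma>)"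
    if "n \<ge> 1" for n
    using that tail_bounds by (cases n) auto
  moreover have "(c / 2) powr \<gamma> > 0" "((\<beta> + 1) * c) powr \<gamma> + ln 2 > 0"
    using c_pos by (auto intro: add_nonneg_pos)
  ultimately show ?thesis
    using C_pos by blast
qed

end
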